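(* For $n\ge 2$ let $f(n)$ denote the maximum size $m$ of an $(n,n)$-bounded cross intersecting set pair system $(\mathcal{A},\mathcal{B})$ such that both $\mathcal{A}$ and $\mathcal{B}$ are 1-intersecting. Let $0.5\le\alpha<1$ be a constant for which there is $x_0$ such that for all real $x\ge x_0$ the interval $[x-x^{\alpha},x]$ contains a prime number. Then for all sufficiently large $n$, $$f(n)\ge n^2-10\,n^{1+\alpha}.$$ In particular, $f(n)\ge n^2-o(n^2)$ as $n\to\infty$.
   Context: A cross intersecting set pair system (SPS) of size $m\ge 2$ consists of finite sets $A_1,\dots,A_m$ and $B_1,\dots,B_m$ such that $A_i\cap B_i=\emptyset$ for every $1\le i\le m$ and $A_i\cap B_j\neq\emptyset$ for all $1\le i\neq j\le m$; one writes $\mathcal{A}=\{A_i\}_{i=1}^m$, $\mathcal{B}=\{B_i\}_{i=1}^m$. It is $(a,b)$-bounded if $|A_i|\le a$ and $|B_i|\le b$ for each $i$. $\mathcal{A}$ (resp. $\mathcal{B}$) is 1-intersecting if $|A_i\cap A_j|=1$ (resp. $|B_i\cap B_j|=1$) for all $i\ne j$. No upper bound is imposed on $|A_i\cap B_j|$ for $i\neq j$. By Hoheisel's theorem a constant $\alpha$ as in the claim exists (e.g. $\alpha=0.525$ by Baker, Harman and Pintz). *)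

theory Defs
  imports Complex_Main "HOL-Computational_Algebra.Primes" "HOL-Library.Landau_Symbols"
begin

definition cross_intersecting_sps ::
  "nat \<Rightarrow> (nat \<Rightarrow> 'a set) \<Rightarrow> (nat \<Rightarrow> 'a set) \<Rightarrow> bool" where
  "cross_intersecting_sps m A B \<longleftrightarrow>
     m \<ge> 2 \<and>
     (\<forall>i\<in>{1..m}. finite (A i) \<and> finite (B i)) \<and>
     (\<forall>i\<in>{1..m}. A i \<inter> B i = {}) \<and>
     (\<forall>i\<in>{1..m}. \<forall>j\<in>{1..m}. i \<noteq> j \<longrightarrow> A i \<inter> B j \<noteq> {})"

definition bounded_sps ::
  "nat \<Rightarrow> nat \<Rightarrow> nat \<Rightarrow> (nat \<Rightarrow> 'a set) \<Rightarrow> (nat \<Rightarrow> 'a set) \<Rightarrow> bool" where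
  "bounded_sps a b m A B \<longleftrightarrow> (\<forall>i\<in>{1..m}. card (A i) \<le> a \<and> card (B i) \<le> b)"

definition one_intersecting :: "nat \<Rightarrow> (nat \<Rightarrow> 'a set) \<Rightarrow> bool" where
  "one_intersecting m A \<longleftrightarrow>
     (\<forall>i\<in>{1..m}. \<forall>j\<in>{1..m}. i \<noteq> j \<longrightarrow> card (A i \<inter> A j) = 1)"

(* Taking the elements to be natural numbers loses no generality: a system consists of
   finitely many finite sets, so its ground set embeds into nat.  For n >= 2 the set below
   is nonempty, and it is finite by the theorem of Bollobas (m <= (2n choose n)), so Max is
   a genuine maximum. *)
definition max_sps_size :: "nat \<Rightarrow> nat" where
  "max_sps_size n =
     Max {m. \<exists>A B :: nat \<Rightarrow> nat set.
            cross_intersecting_sps m A B \<and> bounded_sps n n m A B \<and>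
            one_intersecting m A \<and> one_intersecting m B}"

end

theory Submission
  imports Defs "HOL-Number_Theory.Cong" "HOL-Real_Asymp.Real_Asymp"
begin

text \<open>
  The affine plane of prime order \<open>q\<close> has \<open>q (q + 1)\<close> lines with \<open>q\<close> points each, and any two
  lines of different slope meet in exactly one point. Let \<open>A\<^sub>i\<close> be a line and \<open>B\<^sub>i\<close> a different
  line parallel to it. Every condition then holds for pairs of indices from different parallel
  classes, and \<open>A\<^sub>i\<close> is disjoint from \<open>B\<^sub>i\<close>. Inside one parallel class the required intersections
  are supplied by new points: each class receives its own copy of a small system of \<open>q\<close> pairs, of
  sets of size at most \<open>k\<close>, and the sets of this copy are attached to the lines. Thus the existence
  of a \<open>(k, k)\<close>-bounded system of size \<open>q\<close> yields a \<open>(q + k, q + k)\<close>-bounded system of size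
  \<open>q (q + 1)\<close> (\<open>sps_affine_plane\<close>).

  The step is used twice. A grid gives a \<open>(p, p)\<close>-bounded system of size \<open>p\<close>
  (\<open>sps_grid\<close>), so for a prime \<open>p\<close> there is a \<open>(2 p, 2 p)\<close>-bounded system of size \<open>p (p + 1)\<close>. This
  system serves as the small one for a prime \<open>q \<le> p (p + 1)\<close>, whence \<open>f(q + 2 p) \<ge> q\<^sup>2\<close>
  (\<open>max_sps_size_ge\<close>). Given \<open>n\<close>, the hypothesis on primes provides \<open>p\<close> between \<open>\<surd>n\<close> and
  \<open>2 \<surd>n\<close> and then \<open>q\<close> between \<open>(n - 2 p) - n\<^sup>\<alpha>\<close> and \<open>n - 2 p\<close>. Because \<open>\<alpha> \<ge> 1/2\<close>, this gives
  \<open>q \<ge> n - 5 n\<^sup>\<alpha>\<close>, and squaring produces the constant 10.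

  A lower bound for a maximum of natural numbers also requires that the set in question is bounded,
  which is a crude form of the theorem of Bollobas (\<open>card_cross_intersecting_le\<close>).
\<close>

section \<open>Set pair systems over arbitrary index and ground sets\<close>

text \<open>
  The constructions are indexed by lines and live on disjoint sums, so the index set and the type of
  points are left arbitrary; \<open>card_le_max_sps_size\<close> transfers the outcome to natural numbers.
\<close>
definition sps :: "nat \<Rightarrow> 'i set \<Rightarrow> ('i \<Rightarrow> 'a set) \<Rightarrow> ('i \<Rightarrow> 'a set) \<Rightarrow> bool" where
  "sps n I A B \<longleftrightarrow>
     (\<forall>i\<in>I. finite (A i) \<and> finite (B i) \<and> card (A i) \<le> n \<and> card (B i) \<le> n \<and> A i \<inter> B i = {}) \<and>
     (\<forall>i\<in>I. \<forall>j\<in>I. i \<noteq> j \<longrightarrow>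
        A i \<inter> B j \<noteq> {} \<and> card (A i \<inter> A j) = 1 \<and> card (B i \<inter> B j) = 1)"

text \<open>
  Fix one index \<open>i0\<close>. Every other \<open>B j\<close> contains a point of \<open>A i0\<close>, so it suffices to bound, for
  each of these at most \<open>a\<close> points \<open>x\<close>, the number of \<open>j\<close> with \<open>x \<in> B j\<close>. For those \<open>j\<close> the point \<open>x\<close>
  avoids \<open>A j\<close>, hence it can be deleted from all the \<open>B j\<close> without destroying any intersection,
  and \<open>b\<close> drops by one.
\<close>
lemma card_cross_intersecting_le:
  assumes "finite I"
    and "\<And>i. i \<in> I \<Longrightarrow> finite (A i) \<and> card (A i) \<le> a"
    and "\<And>i. i \<in> I \<Longrightarrow> finite (B i) \<and> card (B i) \<le> b"
    and "\<And>i. i \<in> I \<Longrightarrow> A i \<inter> B i = {}"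
    and "\<And>i j. i \<in> I \<Longrightarrow> j \<in> I \<Longrightarrow> i \<noteq> j \<Longrightarrow> A i \<inter> B j \<noteq> {}"
  shows "card I \<le> (a + 1) ^ b"
  using assms
proof (induction b arbitrary: I B)
  case 0
  then have "B i = {}" if "i \<in> I" for i using "0.prems"(3)[OF that] by auto
  with 0 have "i = j" if "i \<in> I" "j \<in> I" for i j using that by blast
  then show ?case using \<open>finite I\<close> by (auto simp: card_le_Suc0_iff_eq)
next
  case (Suc b)
  show ?case
  proof (cases "I = {}")
    case False
    then obtain i0 where i0: "i0 \<in> I" by blast
    define J where "J x = {j \<in> I. x \<in> B j}" for x
    have J: "card (J x) \<le> (a + 1) ^ b" for x
    proof (rule Suc.IH[of _ "\<lambda>j. B j - {x}"])
      fix i assume i: "i \<in> J x"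
      then have "finite (B i)" "card (B i) \<le> Suc b" "x \<in> B i"
        using Suc.prems(3)[of i] by (auto simp: J_def)
      then show "finite (B i - {x}) \<and> card (B i - {x}) \<le> b" by simp
      show "A i \<inter> (B i - {x}) = {}" using i Suc.prems(4)[of i] by (auto simp: J_def)
    next
      fix i j assume ij: "i \<in> J x" "j \<in> J x" "i \<noteq> j"
      then have "A i \<inter> B j \<noteq> {}" "A i \<inter> B i = {}" "x \<in> B i"
        using Suc.prems(4)[of i] Suc.prems(5)[of i j] by (auto simp: J_def)
      then show "A i \<inter> (B j - {x}) \<noteq> {}" by blast
    qed (use Suc.prems in \<open>auto simp: J_def\<close>)
    have "I \<subseteq> insert i0 (\<Union>x\<in>A i0. J x)"
      using Suc.prems(5)[OF i0] by (auto simp: J_def)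
    then have "card I \<le> card (insert i0 (\<Union>x\<in>A i0. J x))"
      using Suc.prems(1,2) i0 by (intro card_mono) (auto simp: J_def)
    also have "\<dots> \<le> Suc (card (\<Union>x\<in>A i0. J x))" by (rule card_insert_le_m1) auto
    also have "card (\<Union>x\<in>A i0. J x) \<le> (\<Sum>x\<in>A i0. card (J x))"
      using Suc.prems(2)[OF i0] by (intro card_UN_le) auto
    also have "\<dots> \<le> card (A i0) * (a + 1) ^ b"
      using sum_bounded_above[of "A i0" "\<lambda>x. card (J x)"] J by simp
    also have "\<dots> \<le> a * (a + 1) ^ b" using Suc.prems(2)[OF i0] by simp
    also have "Suc (a * (a + 1) ^ b) \<le> (a + 1) ^ Suc b" by simp
    finally show ?thesis by simp
  qed simp
qed

lemma sps_mono: "sps n I A B \<Longrightarrow> n \<le> n' \<Longrightarrow> sps n' I A B"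
  unfolding sps_def by (meson le_trans)

lemma sps_reindex:
  assumes "sps n I A B" and "inj_on h T" and "h ` T \<subseteq> I"
  shows "sps n T (A \<circ> h) (B \<circ> h)"
proof -
  have "h i \<in> I" if "i \<in> T" for i using assms that by auto
  moreover have "h i \<noteq> h j" if "i \<in> T" "j \<in> T" "i \<noteq> j" for i j
    using assms that by (auto simp: inj_on_def)
  ultimately show ?thesis using assms(1) by (simp add: sps_def)
qed

lemma sps_image:
  assumes "sps n I A B" and f: "inj_on f (\<Union>i\<in>I. A i \<union> B i)"
  shows "sps n I (\<lambda>i. f ` A i) (\<lambda>i. f ` B i)"
proof -
  have "card (f ` X) = card X" if "X \<in> A ` I \<union> B ` I" for X
  proof (rule card_image)
    have "X \<subseteq> (\<Union>i\<in>I. A i \<union> B i)" using that by auto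
    with f show "inj_on f X" by (rule inj_on_subset)
  qed
  moreover have "f ` X \<inter> f ` Y = f ` (X \<inter> Y)" "card (f ` (X \<inter> Y)) = card (X \<inter> Y)"
    if "X \<in> A ` I \<union> B ` I" "Y \<in> A ` I \<union> B ` I" for X Y
  proof -
    have "X \<subseteq> (\<Union>i\<in>I. A i \<union> B i)" "Y \<subseteq> (\<Union>i\<in>I. A i \<union> B i)" using that by auto
    then show "f ` X \<inter> f ` Y = f ` (X \<inter> Y)" "card (f ` (X \<inter> Y)) = card (X \<inter> Y)"
      using f by (simp add: inj_on_image_Int, meson card_image inj_on_subset inf.coboundedI1)
  qed
  ultimately show ?thesis using assms(1) by (simp add: sps_def)
qed

lemma card_le_max_sps_size:
  assumes "sps n I A B" and "finite I" and "card I \<ge> 2"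
  shows "card I \<le> max_sps_size n"
proof -
  let ?M = "{m. \<exists>A B :: nat \<Rightarrow> nat set.
            cross_intersecting_sps m A B \<and> bounded_sps n n m A B \<and>
            one_intersecting m A \<and> one_intersecting m B}"
  have "m \<le> (n + 1) ^ n" if "m \<in> ?M" for m
  proof -
    from that obtain A B :: "nat \<Rightarrow> nat set" where
      "cross_intersecting_sps m A B" "bounded_sps n n m A B" by blast
    then show ?thesis
      using card_cross_intersecting_le[of "{1..m}" A n B n]
      by (auto simp: cross_intersecting_sps_def bounded_sps_def)
  qed
  then have fin: "finite ?M" by (meson finite_nat_set_iff_bounded_le)
  obtain h where h: "bij_betw h {1..card I} I"
    using assms(2) ex_bij_betw_nat_finite_1 by blast
  then have re: "sps n {1..card I} (A \<circ> h) (B \<circ> h)"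
    using assms(1) by (intro sps_reindex) (auto simp: bij_betw_def)
  then have "finite (\<Union>i\<in>{1..card I}. (A \<circ> h) i \<union> (B \<circ> h) i)"
    by (simp add: sps_def)
  then obtain f :: "'b \<Rightarrow> nat" where "inj_on f (\<Union>i\<in>{1..card I}. (A \<circ> h) i \<union> (B \<circ> h) i)"
    using finite_imp_inj_to_nat_seg by metis
  from sps_image[OF re this] obtain A' B' :: "nat \<Rightarrow> nat set"
    where "sps n {1..card I} A' B'" by blast
  then have "cross_intersecting_sps (card I) A' B'" "bounded_sps n n (card I) A' B'"
    "one_intersecting (card I) A'" "one_intersecting (card I) B'"
    using assms(3)
    unfolding sps_def cross_intersecting_sps_def bounded_sps_def one_intersecting_def by blast+
  then have "card I \<in> ?M" by blast
  then show ?thesis unfolding max_sps_size_def using fin by (rule Max_ge[rotated])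
qed

section \<open>The two constructions\<close>

text \<open>
  Rows and columns of a square grid without its diagonal: row \<open>i\<close> and column \<open>j\<close> share exactly the
  cell \<open>(i, j)\<close>, which is missing precisely for \<open>i = j\<close>. Rows are pairwise disjoint, as are columns,
  so one extra point common to all rows and another common to all columns make both families
  1-intersecting. The missing cell makes room for the extra point.
\<close>
lemma sps_grid:
  fixes I :: "'i set"
  assumes "finite I"
  defines "A \<equiv> \<lambda>i. insert (Inr True) (Inl ` ({i} \<times> (I - {i})))"
    and "B \<equiv> \<lambda>i. insert (Inr False) (Inl ` ((I - {i}) \<times> {i}))"
  shows "sps (card I) I A (B :: 'i \<Rightarrow> ('i \<times> 'i + bool) set)"
proof -
  have "card (A i) = card I" "card (B i) = card I" if "i \<in> I" for i
  proof -
    have "card (I - {i}) = card I - 1" "card I > 0"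
      using that assms(1) by (auto simp: card_gt_0_iff)
    then show "card (A i) = card I" "card (B i) = card I"
      using assms(1) unfolding A_def B_def
      by (subst card_insert_disjoint; auto simp: card_image card_cartesian_product)+
  qed
  moreover have "A i \<inter> A j = {Inr True}" "B i \<inter> B j = {Inr False}" if "i \<in> I" "j \<in> I" "i \<noteq> j" for i j
    using that by (auto simp: A_def B_def)
  moreover have "A i \<inter> B j \<noteq> {}" if "i \<in> I" "j \<in> I" "i \<noteq> j" for i j
  proof -
    have "Inl (i, j) \<in> A i \<inter> B j" using that by (auto simp: A_def B_def)
    then show ?thesis by blast
  qed
  moreover have "A i \<inter> B i = {}" "finite (A i)" "finite (B i)" for i
    using assms(1) by (auto simp: A_def B_def)
  ultimately show ?thesis by (simp add: sps_def)
qed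

text \<open>
  Think of \<open>s\<close> as a slope and of \<open>t\<close> as an intercept. Tagging the new points with \<open>s\<close> gives each
  parallel class a private copy of the small system, so that new points never spoil an intersection
  across classes. Within a class, injectivity of \<open>\<sigma>\<close> keeps the lines of distinct \<open>B\<close>-sets distinct
  and thus disjoint, and the absence of fixed points separates the two sets of a pair.
\<close>
lemma sps_parallel_classes:
  fixes L :: "'s \<Rightarrow> 't \<Rightarrow> 'p set"
  assumes line: "\<And>s t. s \<in> S \<Longrightarrow> t \<in> T \<Longrightarrow> finite (L s t) \<and> card (L s t) \<le> q"
    and parallel: "\<And>s t t'. s \<in> S \<Longrightarrow> t \<in> T \<Longrightarrow> t' \<in> T \<Longrightarrow> t \<noteq> t' \<Longrightarrow> L s t \<inter> L s t' = {}"
    and meet: "\<And>s s' t t'. s \<in> S \<Longrightarrow> s' \<in> S \<Longrightarrow> s \<noteq> s' \<Longrightarrow> t \<in> T \<Longrightarrow> t' \<in> T \<Longrightarrow>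
                 card (L s t \<inter> L s' t') = 1"
    and shift: "inj_on \<sigma> T" "\<And>t. t \<in> T \<Longrightarrow> \<sigma> t \<in> T \<and> \<sigma> t \<noteq> t"
    and small: "sps k T A B"
  shows "sps (q + k) (S \<times> T) (\<lambda>(s, t). L s t <+> {s} \<times> A t) (\<lambda>(s, t). L s (\<sigma> t) <+> {s} \<times> B t)"
    (is "sps _ _ ?A ?B")
proof -
  have Int: "(X <+> Y) \<inter> (X' <+> Y') = (X \<inter> X') <+> (Y \<inter> Y')" for X X' :: "'p set" and Y Y' :: "('s \<times> 'c) set"
    by auto
  have crd: "card (X <+> Y) = card X + card Y" if "finite X" "finite Y" for X :: "'p set" and Y :: "('s \<times> 'c) set"
    using that by (rule card_Plus)
  have same: "({s} \<times> X) \<inter> ({s} \<times> Y) = {s} \<times> (X \<inter> Y)" for s :: 's and X Y :: "'c set" by auto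
  have diff: "({s} \<times> X) \<inter> ({s'} \<times> Y) = {}" if "s \<noteq> s'" for s s' :: 's and X Y :: "'c set"
    using that by auto
  have bnd: "finite (?A i) \<and> finite (?B i) \<and> card (?A i) \<le> q + k \<and> card (?B i) \<le> q + k \<and> ?A i \<inter> ?B i = {}"
    if iST: "i \<in> S \<times> T" for i
  proof -
    obtain s t where i: "i = (s, t)" "s \<in> S" "t \<in> T" using iST by auto
    have \<sigma>: "\<sigma> t \<in> T" "t \<noteq> \<sigma> t" using shift(2)[OF i(3)] by auto
    have "finite (A t)" "finite (B t)" "card (A t) \<le> k" "card (B t) \<le> k" "A t \<inter> B t = {}"
      using small i(3) by (auto simp: sps_def)
    then show ?thesis
      using line[OF i(2,3)] line[OF i(2) \<sigma>(1)] parallel[OF i(2,3) \<sigma>]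
      by (simp add: i crd Int same card_cartesian_product add_mono)
  qed
  have meets: "?A i \<inter> ?B j \<noteq> {} \<and> card (?A i \<inter> ?A j) = 1 \<and> card (?B i \<inter> ?B j) = 1"
    if ijST: "i \<in> S \<times> T" "j \<in> S \<times> T" "i \<noteq> j" for i j
  proof -
    obtain s t s' t' where ij: "i = (s, t)" "s \<in> S" "t \<in> T" "j = (s', t')" "s' \<in> S" "t' \<in> T"
      using ijST by auto
    have \<sigma>: "\<sigma> t \<in> T" "\<sigma> t' \<in> T" using shift(2) ij by auto
    show ?thesis
    proof (cases "s = s'")
      case True
      then have ne: "t \<noteq> t'" using ij ijST by auto
      then have "\<sigma> t \<noteq> \<sigma> t'" using shift(1) ij by (auto simp: inj_on_def)
      then have disj: "L s t \<inter> L s t' = {}" "L s (\<sigma> t) \<inter> L s (\<sigma> t') = {}"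
        using parallel ij \<sigma> ne by auto
      have *: "A t \<inter> B t' \<noteq> {}" "card (A t \<inter> A t') = 1" "card (B t \<inter> B t') = 1"
        using small ij ne by (auto simp: sps_def)
      then have "finite (A t \<inter> A t')" "finite (B t \<inter> B t')"
        by (metis card.infinite zero_neq_one)+
      then show ?thesis using * unfolding ij prod.case Int True[symmetric] same disj
        by (simp add: crd card_cartesian_product)
    next
      case False
      have *: "card (L s t \<inter> L s' t') = 1" "card (L s (\<sigma> t) \<inter> L s' (\<sigma> t')) = 1"
        "card (L s t \<inter> L s' (\<sigma> t')) = 1"
        using meet[OF ij(2,5) False] ij \<sigma> by auto
      then have "finite (L s t \<inter> L s' t')" "finite (L s (\<sigma> t) \<inter> L s' (\<sigma> t'))"
        "L s t \<inter> L s' (\<sigma> t') \<noteq> {}"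
        by (metis card.infinite zero_neq_one, metis card.infinite zero_neq_one, force)
      then show ?thesis using * unfolding ij prod.case Int diff[OF False]
        by (simp add: crd)
    qed
  qed
  show ?thesis unfolding sps_def
    by (rule conjI; intro ballI impI) (erule bnd, erule (2) meets)
qed

section \<open>Lines of the affine plane over the integers modulo a prime\<close>

text \<open>The slope \<open>p\<close> encodes the vertical direction; the slopes \<open>0, \<dots>, p - 1\<close> are proper residues.\<close>
definition line :: "int \<Rightarrow> int \<Rightarrow> int \<Rightarrow> (int \<times> int) set" where
  "line p s t = (if s = p then {t} \<times> {0..<p} else (\<lambda>x. (x, (s * x + t) mod p)) ` {0..<p})"

lemma card_line: "p > 0 \<Longrightarrow> finite (line p s t) \<and> card (line p s t) = nat p"
  by (auto simp: line_def card_cartesian_product card_image inj_on_def)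

lemma line_parallel:
  assumes "t \<in> {0..<p}" "t' \<in> {0..<p}" "t \<noteq> t'"
  shows "line p s t \<inter> line p s t' = {}"
proof -
  have "(s * x + t) mod p \<noteq> (s * x + t') mod p" for x
  proof
    assume "(s * x + t) mod p = (s * x + t') mod p"
    then have "[s * x + t = s * x + t'] (mod p)" by (simp only: unique_euclidean_semiring_class.cong_def)
    then have "[t = t'] (mod p)" by (simp only: cong_add_lcancel)
    with assms show False using cong_less_imp_eq_int[of t p t'] by auto
  qed
  then show ?thesis using assms(3) by (auto simp: line_def)
qed

text \<open>
  A common point of two non-vertical lines has a first coordinate solving
  \<open>(s' - s) x = t - t'\<close> modulo \<open>p\<close>, and \<open>s' - s\<close> is invertible. Ordering the slopes leaves \<open>s'\<close> as
  the only one that can be vertical.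
\<close>
lemma line_meet_less:
  assumes p: "prime p" and s: "s \<in> {0..p}" "s' \<in> {0..p}" "s < s'"
    and t: "t \<in> {0..<p}" "t' \<in> {0..<p}"
  shows "card (line p s t \<inter> line p s' t') = 1"
proof (cases "s' = p")
  case True
  then have "line p s t \<inter> line p s' t' = {(t', (s * t' + t) mod p)}"
    using s t by (auto simp: line_def)
  then show ?thesis by simp
next
  case False
  have p0: "p > 0" using p prime_gt_0_int by blast
  have "\<not> p dvd s' - s" using s False zdvd_not_zless[of "s' - s" p] by auto
  then have cop: "coprime (s' - s) p"
    using p by (metis coprime_commute prime_imp_coprime)
  then obtain u where u: "[(s' - s) * u = 1] (mod p)" using cong_solve_coprime_int by blast
  define x where "x = (u * (t - t')) mod p"
  have iff: "(s * z + t) mod p = (s' * z + t') mod p \<longleftrightarrow> [(s' - s) * z = t - t'] (mod p)" for z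
  proof -
    have "(s * z + t) - (s' * z + t') = - ((s' - s) * z - (t - t'))" by (simp add: algebra_simps)
    then show ?thesis by (simp only: mod_eq_dvd_iff cong_iff_dvd_diff dvd_minus_iff)
  qed
  have "[(s' - s) * x = ((s' - s) * u) * (t - t')] (mod p)"
    unfolding x_def by (simp only: unique_euclidean_semiring_class.cong_def mod_mult_right_eq mult.assoc)
  also have "[((s' - s) * u) * (t - t') = 1 * (t - t')] (mod p)"
    using u by (rule cong_mult) simp
  finally have x: "[(s' - s) * x = t - t'] (mod p)" by simp
  have xr: "x \<in> {0..<p}" using p0 by (simp add: x_def)
  have uniq: "z = x" if "z \<in> {0..<p}" "[(s' - s) * z = t - t'] (mod p)" for z
  proof -
    have "[(s' - s) * z = (s' - s) * x] (mod p)" using that(2) x cong_sym cong_trans by blast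
    then have "[z = x] (mod p)" using cop by (simp add: cong_mult_lcancel)
    then show ?thesis using that xr cong_less_imp_eq_int[of z p x] by auto
  qed
  have "line p s t \<inter> line p s' t' = {(x, (s * x + t) mod p)}"
  proof -
    have "s \<noteq> p" using s by auto
    then have "line p s t \<inter> line p s' t' =
        {(z, (s * z + t) mod p) | z. z \<in> {0..<p} \<and> (s * z + t) mod p = (s' * z + t') mod p}"
      using False unfolding line_def by auto
    moreover have "z \<in> {0..<p} \<and> (s * z + t) mod p = (s' * z + t') mod p \<longleftrightarrow> z = x" for z
      using iff[of z] x xr uniq[of z] by blast
    ultimately have "line p s t \<inter> line p s' t' = {(z, (s * z + t) mod p) | z. z = x}"
      by (simp only:)
    then show ?thesis by simp
  qed
  then show ?thesis by simp
qed

lemma line_meet: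
  assumes "prime p" and "s \<in> {0..p}" "s' \<in> {0..p}" "s \<noteq> s'"
    and "t \<in> {0..<p}" "t' \<in> {0..<p}"
  shows "card (line p s t \<inter> line p s' t') = 1"
  using line_meet_less[of p s s' t t'] line_meet_less[of p s' s t' t] assms
  by (metis Int_commute linorder_neqE)

section \<open>The lower bound\<close>

lemma sps_affine_plane:
  fixes A B :: "'i \<Rightarrow> 'a set" and p :: nat
  assumes p: "prime p" and small: "sps k I A B" and I: "finite I" "p \<le> card I"
  obtains A' B' :: "int \<times> int \<Rightarrow> (int \<times> int + int \<times> 'a) set"
  where "sps (p + k) ({0..int p} \<times> {0..<int p}) A' B'"
proof -
  have p2: "p \<ge> 2" using p prime_ge_2_nat by blast
  have "card {0..<int p} \<le> card I" using I by simp
  then obtain h where h: "h ` {0..<int p} \<subseteq> I" "inj_on h {0..<int p}"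
    using card_le_inj[of "{0..<int p}" I] I(1) by auto
  \<comment> \<open>any permutation of the intercepts without fixed points would do; this is the cyclic shift\<close>
  define \<sigma> where "\<sigma> t = (if t = int p - 1 then 0 else t + 1)" for t
  have "sps (p + k) ({0..int p} \<times> {0..<int p})
     (\<lambda>(s, t). line (int p) s t <+> {s} \<times> (A \<circ> h) t)
     (\<lambda>(s, t). line (int p) s (\<sigma> t) <+> {s} \<times> (B \<circ> h) t)"
  proof (rule sps_parallel_classes)
    show "sps k {0..<int p} (A \<circ> h) (B \<circ> h)" using sps_reindex[OF small h(2,1)] .
    show "inj_on \<sigma> {0..<int p}" by (auto simp: \<sigma>_def inj_on_def)
  qed (use p p2 card_line[of "int p"] line_parallel[of _ "int p"] line_meet[of "int p"] in
       \<open>auto simp: \<sigma>_def\<close>)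
  then show ?thesis by (rule that)
qed

lemma max_sps_size_ge:
  fixes p q n :: nat
  assumes "prime p" "prime q" "q \<le> p * (p + 1)" "q + 2 * p \<le> n"
  shows "q\<^sup>2 \<le> max_sps_size n"
proof -
  have card: "card ({0..int r} \<times> {0..<int r}) = r * (r + 1)" for r
    by (simp add: card_cartesian_product nat_add_distrib)
  obtain A B :: "int \<times> int \<Rightarrow> (int \<times> int + int \<times> (nat \<times> nat + bool)) set"
    where "sps (p + p) ({0..int p} \<times> {0..<int p}) A B"
    by (rule sps_affine_plane[OF assms(1) sps_grid[of "{..<p}", unfolded card_lessThan]]) simp_all
  then obtain A' B' :: "int \<times> int \<Rightarrow> (int \<times> int + int \<times> (int \<times> int + int \<times> (nat \<times> nat + bool))) set"
    where "sps (q + (p + p)) ({0..int q} \<times> {0..<int q}) A' B'"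
    by (rule sps_affine_plane[OF assms(2)]) (use assms(3) in \<open>simp_all add: card\<close>)
  then have "sps n ({0..int q} \<times> {0..<int q}) A' B'" by (rule sps_mono) (use assms in simp)
  moreover have "2 \<le> q * (q + 1)"
    using prime_ge_2_nat[OF assms(2)] by (simp add: trans_le_add1)
  ultimately have "q * (q + 1) \<le> max_sps_size n"
    using card_le_max_sps_size[of n "{0..int q} \<times> {0..<int q}"] by (simp add: card)
  then show ?thesis by (simp add: power2_eq_square)
qed

theorem mainTheorem9:
  fixes \<alpha> :: real
  assumes "1/2 \<le> \<alpha>" and "\<alpha> < 1"
    and "\<exists>x0::real. \<forall>x\<ge>x0. \<exists>p::nat. prime p \<and> real p \<in> {x - x powr \<alpha> .. x}"
  shows "(\<forall>\<^sub>F n in sequentially.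
            real (max_sps_size n) \<ge> (real n)\<^sup>2 - 10 * real n powr (1 + \<alpha>)) \<and>
         (\<exists>g :: nat \<Rightarrow> real. g \<in> o(\<lambda>n. (real n)\<^sup>2) \<and>
            (\<forall>n\<ge>2. real (max_sps_size n) \<ge> (real n)\<^sup>2 - g n))"
proof
  obtain x0 where x0: "\<And>x. x \<ge> x0 \<Longrightarrow> \<exists>p::nat. prime p \<and> real p \<in> {x - x powr \<alpha> .. x}"
    using assms(3) by blast
  have "\<forall>\<^sub>F n in sequentially. 2 * sqrt (real n) \<ge> x0" by real_asymp
  moreover have "\<forall>\<^sub>F n in sequentially. real n - 4 * sqrt (real n) \<ge> max x0 0" by real_asymp
  moreover have "\<forall>\<^sub>F n in sequentially. (2 * sqrt (real n)) powr \<alpha> \<le> sqrt (real n)"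
    using assms(1,2) by real_asymp
  moreover have "\<forall>\<^sub>F n::nat in sequentially. n \<ge> 1" by (rule eventually_ge_at_top)
  ultimately show ev: "\<forall>\<^sub>F n in sequentially.
            real (max_sps_size n) \<ge> (real n)\<^sup>2 - 10 * real n powr (1 + \<alpha>)"
  proof eventually_elim
    case (elim n)
    obtain p :: nat where p: "prime p"
      "2 * sqrt (real n) - (2 * sqrt (real n)) powr \<alpha> \<le> real p" "real p \<le> 2 * sqrt (real n)"
      using x0[OF elim(1)] by auto
    define x where "x = real n - 2 * real p"
    have x: "x \<ge> x0" "x \<ge> 0" "x \<le> real n" using elim(2) p(3) by (auto simp: x_def)
    obtain q :: nat where q: "prime q" "x - x powr \<alpha> \<le> real q" "real q \<le> x"
      using x0[OF x(1)] by auto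
    have "sqrt (real n) \<le> real p" using p(2) elim(3) by linarith
    then have "real n \<le> (real p)\<^sup>2" by (rule sqrt_le_D)
    then have "real n \<le> real (p\<^sup>2)" by simp
    then have np: "n \<le> p\<^sup>2" by (rule of_nat_le_iff[THEN iffD1])
    have le: "q + 2 * p \<le> n" using q(3) unfolding x_def by linarith
    have size: "q\<^sup>2 \<le> max_sps_size n"
      by (rule max_sps_size_ge[OF p(1) q(1) _ le]) (use np le in \<open>simp add: power2_eq_square\<close>)
    define y where "y = real n powr \<alpha>"
    have "sqrt (real n) \<le> y"
      using elim(4) assms(1) by (simp add: y_def powr_half_sqrt[symmetric] powr_mono)
    moreover have "x powr \<alpha> \<le> y" using x assms(1) by (simp add: y_def powr_mono2)
    ultimately have qy: "real n - 5 * y \<le> real q" using q(2) p(3) by (simp add: x_def)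
    \<comment> \<open>squaring needs a nonnegative left-hand side; where it is negative, so is the claimed bound\<close>
    have "(real n)\<^sup>2 - 10 * (real n * y) \<le> (real q)\<^sup>2"
    proof (cases "real n - 5 * y \<ge> 0")
      case True
      then have "(real n - 5 * y)\<^sup>2 \<le> (real q)\<^sup>2" using qy by (intro power_mono) auto
      moreover have "(real n - 5 * y)\<^sup>2 = (real n)\<^sup>2 - 10 * (real n * y) + (5 * y)\<^sup>2"
        by (simp add: power2_eq_square algebra_simps)
      ultimately show ?thesis using zero_le_power2[of "5 * y"] by linarith
    next
      case False
      then have "real n * real n \<le> real n * (5 * y)" by (intro mult_left_mono) auto
      moreover have "0 \<le> real n * y" by (simp add: y_def)
      ultimately have "(real n)\<^sup>2 - 10 * (real n * y) \<le> 0" unfolding power2_eq_square by linarith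
      also have "0 \<le> (real q)\<^sup>2" by simp
      finally show ?thesis .
    qed
    also have "(real q)\<^sup>2 \<le> real (max_sps_size n)" using size by (metis of_nat_le_iff of_nat_power)
    finally show ?case using elim(4) by (simp add: y_def powr_add)
  qed
  then obtain N where N: "\<And>n. n \<ge> N \<Longrightarrow>
      real (max_sps_size n) \<ge> (real n)\<^sup>2 - 10 * real n powr (1 + \<alpha>)"
    by (auto simp: eventually_sequentially)
  \<comment> \<open>below the threshold the trivial bound 0 suffices, and finitely many values do not affect the growth\<close>
  define g where "g n = (if n \<ge> N then 10 * real n powr (1 + \<alpha>) else (real n)\<^sup>2)" for n
  have "(\<lambda>n. 10 * real n powr (1 + \<alpha>)) \<in> o(\<lambda>n. (real n)\<^sup>2)" using assms(2) by real_asymp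
  moreover have "\<forall>\<^sub>F n in sequentially. 10 * real n powr (1 + \<alpha>) = g n"
    using eventually_ge_at_top[of N] by eventually_elim (simp add: g_def)
  ultimately have "g \<in> o(\<lambda>n. (real n)\<^sup>2)"
    by (simp only: landau_o.small.in_cong)
  moreover have "real (max_sps_size n) \<ge> (real n)\<^sup>2 - g n" for n
    using N[of n] by (simp add: g_def)
  ultimately show "\<exists>g :: nat \<Rightarrow> real. g \<in> o(\<lambda>n. (real n)\<^sup>2) \<and>
            (\<forall>n\<ge>2. real (max_sps_size n) \<ge> (real n)\<^sup>2 - g n)" by blast
qed

end
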